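(* Let $F(t)=\frac{1}{2}(t^2-t+1)$ and $G(t)=\frac{1}{2}(t^2+t+1)=F(-t)$. Let $f,g\in\mathbb{Q}[t]$ with $\deg f=\deg g=2$, and call $(f,g)$ a solution if $g$ divides $f^3+1$ and $f$ divides $g^3+1$ in $\mathbb{Q}[t]$. Call $(f,g)$ trivial if there exist $f_1,g_1,h\in\mathbb{Q}[t]$ with $\deg h\ge 2$ such that $f=f_1\circ h$ and $g=g_1\circ h$. Then $(f,g)$ is a non-trivial solution if and only if there exist $\alpha\in\mathbb{Q}\setminus\{0\}$ and $\beta\in\mathbb{Q}$ such that $f(t)=F(\alpha t+\beta)$ and $g(t)=G(\alpha t+\beta)$.
   Context: Non-trivial solutions are considered only up to affine reparametrization $t\mapsto \alpha t+\beta$ with $\alpha\in\mathbb{Q}\setminus\{0\}$, $\beta\in\mathbb{Q}$; this is how the paper's normalization of non-trivial solutions (no composition with a polynomial of degree at least $2$, and normalization of the linear substitution) is expressed here. *)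

theory Defs
  imports "HOL-Computational_Algebra.Polynomial"
begin

definition F :: "rat poly" where
  "F = smult (1 / 2) [:1, -1, 1:]"

definition G :: "rat poly" where
  "G = smult (1 / 2) [:1, 1, 1:]"

definition is_solution :: "rat poly \<Rightarrow> rat poly \<Rightarrow> bool" where
  "is_solution f g \<longleftrightarrow> g dvd f ^ 3 + 1 \<and> f dvd g ^ 3 + 1"

definition is_trivial :: "rat poly \<Rightarrow> rat poly \<Rightarrow> bool" where
  "is_trivial f g \<longleftrightarrow>
     (\<exists>f\<^sub>1 g\<^sub>1 h :: rat poly. degree h \<ge> 2 \<and> f = pcompose f\<^sub>1 h \<and> g = pcompose g\<^sub>1 h)"

lemma G_eq_F_reflected: "G = pcompose F [:0, -1:]"
  by (simp add: F_def G_def pcompose_pCons)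

end

theory Submission
  imports Defs
begin

text \<open>
  Write \<open>f = k g + L\<close> with \<open>deg L \<le> 1\<close>. If \<open>L\<close> is constant, the pair is trivial with \<open>h = g\<close>.
  Otherwise \<open>g\<close> is a quadratic divisor of \<open>L\<^sup>3 + 1 = (L + 1) (L\<^sup>2 - L + 1)\<close>, so it is proportional
  to the second factor. Symmetrically \<open>g = f / k - L / k\<close> forces \<open>f\<close> to be proportional to
  \<open>M\<^sup>2 - M + 1\<close> with \<open>M = - L / k\<close>. Comparing the two expressions for \<open>f\<close> as polynomials in \<open>L\<close>
  gives \<open>k = 1\<close>, \<open>f = G \<circ> L = F \<circ> (- L)\<close> and \<open>g = F \<circ> L = G \<circ> (- L)\<close>.
  Conversely \<open>G \<circ> \<ell> - F \<circ> \<ell> = \<ell>\<close> has degree 1, which excludes a common inner polynomial of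
  degree at least 2.
\<close>

lemma degree_2_pCons:
  fixes p :: "'a::zero poly"
  assumes "degree p = 2"
  obtains a b c where "p = [:a, b, c:]" "c \<noteq> 0"
proof -
  have "p = [:coeff p 0, coeff p 1, coeff p 2:]"
    using assms by (intro poly_eqI) (auto simp: coeff_pCons coeff_eq_0 numeral_2_eq_2 split: nat.splits)
  moreover have "coeff p 2 \<noteq> 0"
    using assms by (metis leading_coeff_0_iff degree_0 zero_neq_numeral)
  ultimately show thesis using that by blast
qed

lemma degree_1_pCons:
  fixes p :: "'a::zero poly"
  assumes "degree p = 1"
  obtains a b where "p = [:a, b:]" "b \<noteq> 0"
proof -
  have "p = [:coeff p 0, coeff p 1:]"
    using assms by (intro poly_eqI) (auto simp: coeff_pCons coeff_eq_0 split: nat.splits)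
  moreover have "coeff p 1 \<noteq> 0"
    using assms by (metis leading_coeff_0_iff degree_0 zero_neq_one)
  ultimately show thesis using that by blast
qed

text \<open>The cofactor of \<open>p\<close> is linear, \<open>s + w t\<close>. Comparing
  coefficients yields \<open>w^3 = s^3\<close>, and in an ordered field this forces
  \<open>w = s\<close>; no irreducibility or unique factorization is invoked.\<close>

lemma quadratic_dvd_cube_plus_1:
  fixes p :: "'a::linordered_field poly"
  assumes "degree p = 2" "p dvd [:1, 0, 0, 1:]"
  obtains c where "c \<noteq> 0" "p = smult c [:1, -1, 1:]"
proof -
  obtain a b c where p: "p = [:a, b, c:]" "c \<noteq> 0"
    using degree_2_pCons[OF assms(1)] .
  obtain q where q: "[:1, 0, 0, 1:] = p * q" using assms(2) by (elim dvdE)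
  have "q \<noteq> 0" "p \<noteq> 0" using q p by auto
  then have "degree p + degree q = 3"
    using q by (metis degree_mult_eq degree_pCons_eq degree_pCons_0 one_neq_zero pCons_eq_0_iff numeral_3_eq_3)
  then have "degree q = 1" using assms(1) by simp
  then obtain s w where qq: "q = [:s, w:]" by (metis degree_1_pCons)
  have e: "a * s = 1" "a * w + b * s = 0" "b * w + c * s = 0" "c * w = 1"
    using q by (auto simp: p qq algebra_simps)
  have nz: "s \<noteq> 0" "w \<noteq> 0" using e by auto
  have a: "a = 1 / s" and c: "c = 1 / w" using e nz by (auto simp: field_simps)
  have "b = - (w / s^2)" using e(2) nz unfolding a by (simp add: field_simps power2_eq_square)
  moreover have "b = - (s / w^2)" using e(3) nz unfolding c by (simp add: field_simps power2_eq_square)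
  ultimately have "w^3 = s^3" using nz by (simp add: field_simps power2_eq_square power3_eq_cube)
  \<comment> \<open>Twice the factor \<open>w^2 + w s + s^2\<close> of \<open>w^3 - s^3\<close> is a
    sum of squares, hence positive and cancellable.\<close>
  moreover have "2 * (w^3 - s^3) = (w - s) * ((w^2 + s^2) + (w + s)^2)"
    by (simp add: power2_eq_square power3_eq_cube algebra_simps)
  moreover have "(w^2 + s^2) + (w + s)^2 > 0"
    using nz by (intro add_pos_nonneg) (simp_all add: sum_power2_gt_zero_iff)
  ultimately have "w = s" by simp
  then have "p = smult c [:1, -1, 1:]"
    using a c \<open>b = - (w / s^2)\<close> nz p(1) by (simp add: power2_eq_square)
  with p(2) show thesis using that by blast
qed

lemma linear_pcompose_inverse:
  fixes L :: "'a::field poly"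
  assumes "degree L = 1"
  obtains S where "degree S = 1" "pcompose L S = [:0, 1:]" "pcompose S L = [:0, 1:]"
proof -
  obtain a b where L: "L = [:a, b:]" "b \<noteq> 0" using degree_1_pCons[OF assms] .
  show thesis
    by (rule that[of "[:- a / b, 1 / b:]"]) (use L in \<open>simp_all add: pcompose_pCons\<close>)
qed

lemma pcompose_inj:
  fixes p q L :: "'a::idom poly"
  assumes "degree L > 0" "pcompose p L = pcompose q L"
  shows "p = q"
proof -
  have "pcompose (p - q) L = 0" using assms by (simp add: pcompose_diff)
  then have "p - q = 0" using assms(1) by (metis pcompose_eq_0)
  then show ?thesis by simp
qed

text \<open>A linear \<open>L\<close> is invertible under composition: substituting its inverse
  \<open>S\<close> turns \<open>L ^ 3 + 1\<close> into \<open>t^3 + 1\<close>, and composing with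
  \<open>L\<close> transports the answer back.\<close>

lemma quadratic_dvd_linear_cube_plus_1:
  fixes g L :: "'a::linordered_field poly"
  assumes "degree g = 2" "degree L = 1" "g dvd L ^ 3 + 1"
  obtains c where "c \<noteq> 0" "g = pcompose (smult c [:1, -1, 1:]) L"
proof -
  obtain S where S: "degree S = 1" "pcompose L S = [:0, 1:]" "pcompose S L = [:0, 1:]"
    using linear_pcompose_inverse[OF assms(2)] .
  obtain q where q: "L ^ 3 + 1 = g * q" using assms(3) by (elim dvdE)
  have "pcompose (L ^ 3 + 1) S = [:1, 0, 0, 1:]"
    by (simp add: pcompose_add pcompose_mult power3_eq_cube S one_pCons)
  then have "pcompose g S dvd [:1, 0, 0, 1:]"
    by (metis q pcompose_mult dvd_triv_left)
  moreover have "degree (pcompose g S) = 2" using assms(1) S by (simp add: degree_pcompose)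
  ultimately obtain c where "c \<noteq> 0" "pcompose g S = smult c [:1, -1, 1:]"
    using quadratic_dvd_cube_plus_1 by blast
  moreover have "pcompose (pcompose g S) L = g"
    by (metis S(3) pcompose_assoc pcompose_idR)
  ultimately show thesis using that by metis
qed

text \<open>\<open>f\<close> and \<open>L\<close> are congruent modulo \<open>g\<close>, hence so
  are their cubes.\<close>

lemma dvd_cube_plus_1_mod:
  fixes f g L :: "'a::comm_ring_1 poly"
  assumes "f = smult k g + L" "g dvd f ^ 3 + 1"
  shows "g dvd L ^ 3 + 1"
proof -
  have "L ^ 3 + 1 = (f ^ 3 + 1) - (f - L) * (f^2 + f * L + L^2)"
    by (simp add: power2_eq_square power3_eq_cube algebra_simps)
  moreover have "f - L = smult k g" using assms(1) by simp
  ultimately have "L ^ 3 + 1 = (f ^ 3 + 1) - smult k g * (f^2 + f * L + L^2)" by simp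
  then show ?thesis using assms(2)
    by (metis dvd_diff dvd_mult2 dvd_smult dvd_refl)
qed

lemma nontrivial_solution_imp:
  assumes deg: "degree f = 2" "degree g = 2" and sol: "is_solution f g" and nt: "\<not> is_trivial f g"
  shows "\<exists>\<alpha> \<beta> :: rat. \<alpha> \<noteq> 0 \<and> f = pcompose F [:\<beta>, \<alpha>:] \<and> g = pcompose G [:\<beta>, \<alpha>:]"
proof -
  obtain a b c where f: "f = [:a, b, c:]" "c \<noteq> 0" using degree_2_pCons[OF deg(1)] .
  obtain a' b' c' where g: "g = [:a', b', c':]" "c' \<noteq> 0" using degree_2_pCons[OF deg(2)] .
  \<comment> \<open>The ratio of leading coefficients makes the quadratic term of
    \<open>f - k g\<close> vanish.\<close>
  define k where "k = c / c'"
  define L where "L = [:a - k * a', b - k * b':]"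
  have k: "k \<noteq> 0" using f g by (simp add: k_def)
  have fL: "f = smult k g + L" using f g by (simp add: k_def L_def)
  have "b - k * b' \<noteq> 0"
  proof
    assume "b - k * b' = 0"
    then have "f = pcompose [:a - k * a', k:] g" "g = pcompose [:0, 1:] g"
      using fL by (simp_all add: L_def pcompose_pCons)
    with nt deg(2) show False unfolding is_trivial_def by (metis order_refl)
  qed
  then have dL: "degree L = 1" by (simp add: L_def)
  have "g dvd L ^ 3 + 1"
    using sol dvd_cube_plus_1_mod[OF fL] by (simp add: is_solution_def)
  then obtain r where r: "r \<noteq> 0" "g = pcompose (smult r [:1, -1, 1:]) L"
    using quadratic_dvd_linear_cube_plus_1[OF deg(2) dL] by blast
  define M where "M = smult (- 1 / k) L"
  have gM: "g = smult (1 / k) f + M" using k by (simp add: fL M_def smult_add_right)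
  have dM: "degree M = 1" using k dL by (simp add: M_def)
  have "f dvd M ^ 3 + 1"
    using sol dvd_cube_plus_1_mod[OF gM] by (simp add: is_solution_def)
  then obtain d where d: "d \<noteq> 0" "f = pcompose (smult d [:1, -1, 1:]) M"
    using quadratic_dvd_linear_cube_plus_1[OF deg(1) dM] by blast
  have f_eq: "f = pcompose [:k * r, 1 - k * r, k * r:] L"
    unfolding fL r(2)
    by (simp add: pcompose_pCons algebra_simps smult_diff_left smult_diff_right smult_add_right)
  have M_eq: "M = pcompose [:0, - 1 / k:] L" by (simp add: M_def pcompose_pCons)
  have "f = pcompose [:d, d / k, d / k^2:] L"
    unfolding d(2) M_eq pcompose_assoc
    by (rule arg_cong[where f = "\<lambda>p. pcompose p L"])
      (use k in \<open>simp add: pcompose_pCons field_simps power2_eq_square\<close>)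
  \<comment> \<open>Both quadratics give \<open>f\<close> after composition with the nonconstant
    \<open>L\<close>, so their coefficients agree.\<close>
  then have "[:k * r, 1 - k * r, k * r:] = [:d, d / k, d / k^2:]"
    using f_eq pcompose_inj[of L] dL by (metis zero_less_one)
  then have e: "d = k * r" "1 - k * r = r" "k * r = r / k"
    using k by (auto simp: power2_eq_square)
  have "k^2 = 1" using e(3) k r(1) by (simp add: field_simps power2_eq_square)
  \<comment> \<open>The other root \<open>k = -1\<close> would turn \<open>1 - k * r = r\<close>
    into \<open>1 + r = r\<close>.\<close>
  then have "k = 1" using e(2) by (auto simp: power2_eq_1_iff)
  then have r2: "r = 1 / 2" using e(2) by simp
  \<comment> \<open>The formulas now read \<open>f = G(L)\<close> and \<open>g = F(L)\<close>; the
    reflection \<open>G(t) = F(-t)\<close> swaps the roles, hence the sign of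
    \<open>L\<close>.\<close>
  have "f = pcompose F (- L)" "g = pcompose G (- L)"
    unfolding f_eq r(2) r2 \<open>k = 1\<close>
    by (simp_all add: F_def G_def pcompose_pCons algebra_simps smult_add_right smult_diff_right)
  moreover obtain \<beta> \<alpha> where "- L = [:\<beta>, \<alpha>:]" "\<alpha> \<noteq> 0"
    using degree_1_pCons[of "- L"] dL by auto
  ultimately show ?thesis by metis
qed

lemma F_G_solution: "is_solution F G"
proof -
  \<comment> \<open>The quartic is \<open>(t^2 - t + 3) (t^2 - 3 t + 3)\<close>: the first factor is
    \<open>2 (F + 1)\<close>, the second is \<open>2 (F^2 - F + 1) / G\<close>. The other identity
    follows the same pattern under \<open>t\<close> to \<open>-t\<close>.\<close>
  have "F ^ 3 + 1 = G * smult (1/4) [:9, -12, 9, -4, 1:]"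
    by (simp add: F_def G_def power3_eq_cube one_pCons)
  moreover have "G ^ 3 + 1 = F * smult (1/4) [:9, 12, 9, 4, 1:]"
    by (simp add: F_def G_def power3_eq_cube one_pCons)
  ultimately show ?thesis unfolding is_solution_def by (metis dvd_triv_left)
qed

lemma is_solution_pcompose:
  assumes "is_solution f g"
  shows "is_solution (pcompose f h) (pcompose g h)"
proof -
  have "pcompose p h dvd pcompose q h ^ 3 + 1" if "p dvd q ^ 3 + 1" for p q :: "rat poly"
  proof -
    from that obtain s where "q ^ 3 + 1 = p * s" ..
    then have "pcompose (q ^ 3 + 1) h = pcompose p h * pcompose s h" by (simp add: pcompose_mult)
    then show ?thesis
      by (simp add: pcompose_add pcompose_mult power3_eq_cube pcompose_1)
  qed
  then show ?thesis using assms by (simp add: is_solution_def)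
qed

text \<open>A common inner polynomial \<open>h\<close> is also inner for \<open>g - f\<close>, so
  \<open>degree h\<close> would divide 1.\<close>

lemma not_is_trivial_if_degree_diff_1:
  assumes "degree (g - f) = 1"
  shows "\<not> is_trivial f g"
proof
  assume "is_trivial f g"
  then obtain f1 g1 h where h: "degree h \<ge> 2" "f = pcompose f1 h" "g = pcompose g1 h"
    unfolding is_trivial_def by blast
  then have "degree (g1 - f1) * degree h = 1"
    using assms by (metis degree_pcompose pcompose_diff)
  with h(1) show False by simp
qed

theorem theorem2p1:
  fixes f g :: "rat poly"
  assumes "degree f = 2" and "degree g = 2"
  shows "(is_solution f g \<and> \<not> is_trivial f g) \<longleftrightarrow>
         (\<exists>\<alpha> \<beta> :: rat. \<alpha> \<noteq> 0 \<and> f = pcompose F [:\<beta>, \<alpha>:] \<and> g = pcompose G [:\<beta>, \<alpha>:])"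
proof
  assume "is_solution f g \<and> \<not> is_trivial f g"
  then show "\<exists>\<alpha> \<beta>. \<alpha> \<noteq> 0 \<and> f = pcompose F [:\<beta>, \<alpha>:] \<and> g = pcompose G [:\<beta>, \<alpha>:]"
    using nontrivial_solution_imp assms by blast
next
  assume "\<exists>\<alpha> \<beta>. \<alpha> \<noteq> 0 \<and> f = pcompose F [:\<beta>, \<alpha>:] \<and> g = pcompose G [:\<beta>, \<alpha>:]"
  then obtain \<alpha> \<beta> where ab: "\<alpha> \<noteq> 0" "f = pcompose F [:\<beta>, \<alpha>:]" "g = pcompose G [:\<beta>, \<alpha>:]"
    by blast
  have "G - F = [:0, 1:]" by (simp add: F_def G_def)
  then have "g - f = [:\<beta>, \<alpha>:]" using ab by (simp flip: pcompose_diff add: pcompose_pCons)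
  then show "is_solution f g \<and> \<not> is_trivial f g"
    using ab is_solution_pcompose[OF F_G_solution] not_is_trivial_if_degree_diff_1 by simp
qed

end
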